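(* Let $C=\langle g(x)\rangle$ be a cyclic code of length $n$ over $\mathbb{F}_q$, where $\gcd(n,q)=1$. Let $\{i_1,\ldots,i_t\}$ be the set of all leaders of $q$-cyclotomic cosets modulo $n$, and $T=\{\alpha^{i_j}: 1\le j\le t\}$. Suppose that $\mathrm{BZ}(C^\perp)=T_1\cup T_2$, and the following holds. (i) For any $\alpha^{i_j}\in T_1$, either $B_{i_j}=B_{-i_j}$ or $\alpha^{-i_j}\in T_1$. (ii) For any $\alpha^{i_j}\in T_2$, $B_{i_j}\cap B_{-i_j}=\emptyset$ and $\alpha^{-i_j}\notin T_2$. Then $\mathrm{BZ}((\mathrm{Hull}(C))^\perp)=T_2$ and $$h(C)=\sum_{\alpha^{i_j}\in T_2}|B_{i_j}|.$$
   Context: Here $q$ is a prime power, $n$ is a positive integer, and $\alpha$ is a primitive $n$-th root of unity over $\mathbb{F}_q$. A linear code of length $n$ over $\mathbb{F}_q$ is a subspace of $\mathbb{F}_q^n$; $C^\perp$ denotes its dual under the Euclidean inner product. $\mathrm{Hull}(C)=C\cap C^\perp$ and $h(C)$ is the dimension of $\mathrm{Hull}(C)$ over $\mathbb{F}_q$. A linear code is cyclic if every cyclic shift of a codeword is a codeword; identifying $(c_0,\ldots,c_{n-1})$ with $\sum c_ix^i$, a cyclic code is an ideal of $\mathbb{F}_q[x]/(x^n-1)$, and $C=\langle g(x)\rangle$ means that $g(x)$ is its generator polynomial, the monic divisor of $x^n-1$ generating it. Duals and intersections of cyclic codes are cyclic. The $q$-cyclotomic coset of an integer $a$ modulo $n$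 is $B_a=\{a,aq,\ldots,aq^{\delta_a-1}\}$ (reduced modulo $n$), where $\delta_a=|B_a|$ is the smallest positive integer with $aq^{\delta_a}\equiv a \pmod n$. These cosets partition $\mathbb{Z}_n$; the set of coset leaders contains exactly one representative of each coset. The minimal polynomial of $\alpha^i$ over $\mathbb{F}_q$ is $m_{\alpha^i}(x)=\prod_{s\in B_i}(x-\alpha^s)$. If $E$ is a cyclic code of length $n$ such that the generator polynomial of $E^\perp$ is $\prod_{j\in S}m_{\alpha^{i_j}}(x)$ with $S\subseteq\{1,\ldots,t\}$, then the basic dual zero of $E$ is $\mathrm{BZ}(E^\perp)=\{\alpha^{i_j}: j\in S\}$. This is applied with $E=C$ and $E=\mathrm{Hull}(C)$. The conditions $\alpha^{-i_j}\in T_1$ and $\alpha^{-i_j}\notin T_2$ are understood up to the choice of coset representative: they refer to $\alpha^{i_k}$ for the leader $i_k$ with $i_k\in B_{-i_j}$.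
   Formalization: The union BZ(C^⊥)=T_1∪T_2 is assumed to be disjoint; without this the claim is false (e.g. q=2, n=7, T_1={α,α^3}, T_2={α}), and whenever T_1 and T_2 overlap the conclusion fails. *)

theory Defs
  imports "HOL-Library.Cardinality" "Jordan_Normal_Form.VS_Connect"
begin

definition linear_code :: "nat \<Rightarrow> 'a :: field vec set \<Rightarrow> bool" where
  "linear_code n C \<longleftrightarrow> VectorSpace.subspace class_ring C (module_vec TYPE('a) n)"

definition dual_code :: "nat \<Rightarrow> 'a :: field vec set \<Rightarrow> 'a vec set" where
  "dual_code n C = {v \<in> carrier_vec n. \<forall>c\<in>C. v \<bullet> c = 0}"

definition hull_code :: "nat \<Rightarrow> 'a :: field vec set \<Rightarrow> 'a vec set" where
  "hull_code n C = C \<inter> dual_code n C"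

definition hull_dim :: "nat \<Rightarrow> 'a :: field vec set \<Rightarrow> nat" where
  "hull_dim n C =
     vectorspace.dim class_ring ((module_vec TYPE('a) n)\<lparr>carrier := hull_code n C\<rparr>)"

(* (c_0, ..., c_{n-1}) is sent to (c_{n-1}, c_0, ..., c_{n-2}). *)
definition cyclic_shift :: "nat \<Rightarrow> 'a vec \<Rightarrow> 'a vec" where
  "cyclic_shift n c = vec n (\<lambda>i. c $ ((i + n - 1) mod n))"

definition cyclic_code :: "nat \<Rightarrow> 'a :: field vec set \<Rightarrow> bool" where
  "cyclic_code n C \<longleftrightarrow> linear_code n C \<and> (\<forall>c\<in>C. cyclic_shift n c \<in> C)"

definition code_poly :: "'a :: field vec \<Rightarrow> 'a poly" where
  "code_poly c = Poly (list_of_vec c)"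

(* Classes in F[x]/(x^n - 1) are represented by their remainders modulo x^n - 1, so the last
   conjunct says that C is the ideal of F[x]/(x^n - 1) generated by the class of g. *)
definition generator_poly :: "nat \<Rightarrow> 'a :: field vec set \<Rightarrow> 'a poly \<Rightarrow> bool" where
  "generator_poly n C g \<longleftrightarrow>
     lead_coeff g = 1 \<and> g dvd monom 1 n - 1 \<and>
     C = {c \<in> carrier_vec n. \<exists>a. code_poly c = (a * g) mod (monom 1 n - 1)}"

definition primitive_root_of_unity :: "nat \<Rightarrow> 'b :: field \<Rightarrow> bool" where
  "primitive_root_of_unity n x \<longleftrightarrow> x ^ n = 1 \<and> (\<forall>k. 0 < k \<and> k < n \<longrightarrow> x ^ k \<noteq> 1)"

(* The field extension is given by the embedding phi of the base field. *)
definition min_poly :: "('a :: field \<Rightarrow> 'b :: field) \<Rightarrow> 'b \<Rightarrow> 'a poly" where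
  "min_poly \<phi> x = (THE p. lead_coeff p = 1 \<and> poly (map_poly \<phi> p) x = 0 \<and>
     (\<forall>r. r \<noteq> 0 \<and> poly (map_poly \<phi> r) x = 0 \<longrightarrow> degree p \<le> degree r))"

definition coset_size :: "nat \<Rightarrow> nat \<Rightarrow> int \<Rightarrow> nat" where
  "coset_size q n a = (LEAST d. 0 < d \<and> (a * int q ^ d) mod int n = a mod int n)"

definition cyclotomic_coset :: "nat \<Rightarrow> nat \<Rightarrow> int \<Rightarrow> int set" where
  "cyclotomic_coset q n a = (\<lambda>j. (a * int q ^ j) mod int n) ` {..<coset_size q n a}"

definition coset_leaders :: "nat \<Rightarrow> nat \<Rightarrow> int set \<Rightarrow> bool" where
  "coset_leaders q n L \<longleftrightarrow>
     L \<subseteq> {0..<int n} \<and> (\<forall>a. \<exists>!i. i \<in> L \<and> i \<in> cyclotomic_coset q n a)"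

(* For a cyclic code E and D its dual, basic_dual_zero phi alpha n L D is BZ(D) = BZ(dual of E),
   relative to the leaders L. *)
definition basic_dual_zero ::
  "('a :: field \<Rightarrow> 'b :: field) \<Rightarrow> 'b \<Rightarrow> nat \<Rightarrow> int set \<Rightarrow> 'a vec set \<Rightarrow> 'b set" where
  "basic_dual_zero \<phi> \<alpha> n L D =
     (THE Z. \<exists>S\<subseteq>L. generator_poly n D (\<Prod>i\<in>S. min_poly \<phi> (\<alpha> powi i)) \<and>
                   Z = (\<lambda>i. \<alpha> powi i) ` S)"

end

theory Submission
  imports Defs "Jordan_Normal_Form.Char_Poly" "HOL-Number_Theory.Cong"
begin

text \<open>
  A cyclic code consists of the words whose polynomial vanishes on a Frobenius-closed set Z of
  n-th roots of unity. The words v and c have cyclic correlation r with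
  r(x) = v(1/x) c(x) on the roots of unity, so v is orthogonal to all shifts of c iff this product
  vanishes there; hence the zeros of the dual code are D = {x. 1/x \<notin> Z}. The hull has the
  zeros Z \<union> D, and its dual the zeros R = {x \<in> D. 1/x \<notin> D}. Condition (i) puts
  the orbits of T1 outside R and condition (ii) puts those of T2 inside it. The dimension follows
  by counting: a code with zero set W has q^(n - |W|) words, and inversion maps R onto the
  complement of Z \<union> D.
\<close>

section \<open>Finite fields and products of linear factors\<close>

text \<open>Zero sets live in the extension field and codes over the base field, so the two must
  determine each other. First, the powers of \<open>\<alpha>\<close> are n distinct roots of x^n -
  1, which therefore splits with simple roots, so a monic divisor is known by its roots. Second, the
  elements fixed by the Frobenius map are exactly the image of \<open>hom\<close>, so a product of
  linear factors over a Frobenius-closed set has its coefficients in the base field. Third, that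
  product, read as a word, is nonzero at every root of unity outside the set. Under \<open>s\<close>
  to \<open>\<alpha> powi s\<close>, cyclotomic cosets become Frobenius orbits and negation becomes
  inversion. Conditions (i) and (ii) speak of leaders only and have to be carried to whole orbits;
  likewise \<open>basic_dual_zero\<close> records only leaders, so the equation to prove is that R
  meets T in T2, not that R equals T2.\<close>

lemma finite_field_power_card: "(a :: 'a :: {field, finite}) ^ CARD('a) = a"
proof (cases "a = 0")
  case False
  let ?U = "UNIV - {0 :: 'a}"
  have "bij_betw ((*) a) ?U ?U"
    by (rule bij_betw_byWitness[where f' = "(*) (inverse a)"]) (use False in \<open>auto simp: field_simps\<close>)
  then have "(\<Prod>x\<in>?U. a * x) = \<Prod>?U"
    by (rule prod.reindex_bij_betw)
  then have "a ^ card ?U * \<Prod>?U = \<Prod>?U"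
    by (simp add: prod.distrib)
  moreover have "\<Prod>?U \<noteq> 0"
    by simp
  ultimately have "a ^ card ?U = 1"
    by simp
  moreover have "CARD('a) = Suc (card ?U)"
    using card_Suc_Diff1[of UNIV "0 :: 'a"] by simp
  ultimately show ?thesis
    by (simp only: power_Suc mult_1_right)
qed (simp add: power_0_left)

lemma card_field_ge_2: "2 \<le> CARD('a :: {field, finite})"
proof -
  have "card {0, 1 :: 'a} \<le> CARD('a)"
    by (rule card_mono) auto
  then show ?thesis by simp
qed

text \<open>Induction on \<open>W\<close>: the cofactor left by the old factors must vanish at the
  new point, because none of those factors does. This turns every divisibility question below into
  one about vanishing.\<close>

lemma prod_linear_dvd:
  fixes p :: "'b :: field poly"
  assumes "finite W"
  shows "(\<Prod>x\<in>W. [:- x, 1:]) dvd p \<longleftrightarrow> (\<forall>x\<in>W. poly p x = 0)"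
proof
  show "\<forall>x\<in>W. poly p x = 0" if "(\<Prod>x\<in>W. [:- x, 1:]) dvd p"
    using that assms by (auto elim!: dvdE simp: poly_prod)
  show "(\<Prod>x\<in>W. [:- x, 1:]) dvd p" if "\<forall>x\<in>W. poly p x = 0"
    using assms that
  proof (induction W)
    case (insert y W)
    then obtain r where r: "p = (\<Prod>x\<in>W. [:- x, 1:]) * r"
      by auto
    have "poly r y = 0"
      using insert r by (auto simp: poly_prod)
    then have "[:- y, 1:] dvd r"
      by (simp add: poly_eq_0_iff_dvd)
    then have "[:- y, 1:] * (\<Prod>x\<in>W. [:- x, 1:]) dvd r * (\<Prod>x\<in>W. [:- x, 1:])"
      by (rule mult_dvd_mono) simp
    then show ?case
      unfolding r prod.insert[OF insert.hyps(1,2)] by (simp only: mult.commute)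
  qed simp
qed

lemma poly_prod_linear_eq_0_iff:
  fixes y :: "'b :: field"
  assumes "finite W"
  shows "poly (\<Prod>x\<in>W. [:- x, 1:]) y = 0 \<longleftrightarrow> y \<in> W"
  using assms by (auto simp: poly_prod)

lemma degree_prod_linear: "degree (\<Prod>x\<in>W. [:- x, 1 :: 'b :: field:]) = card W"
  by (cases "finite W") (auto simp: degree_prod_eq_sum_degree)

lemma monic_prod_linear: "lead_coeff (\<Prod>x\<in>W. [:- x, 1 :: 'b :: field:]) = 1"
  by (simp add: lead_coeff_prod)

text \<open>The product divides \<open>p\<close>; equal degrees and leading coefficients leave 1 as
  the only cofactor.\<close>

lemma monic_eq_prod_linear:
  fixes p :: "'b :: field poly"
  assumes "finite W" "lead_coeff p = 1" "\<And>x. x \<in> W \<Longrightarrow> poly p x = 0" "card W = degree p"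
  shows "p = (\<Prod>x\<in>W. [:- x, 1:])"
proof -
  let ?m = "\<Prod>x\<in>W. [:- x, 1:]"
  obtain r where r: "p = ?m * r"
    using prod_linear_dvd[of W p] assms(1,3) by (auto elim!: dvdE)
  have nz: "p \<noteq> 0" "?m \<noteq> 0"
    using assms(2) monic_prod_linear[of W] by auto
  then have "r \<noteq> 0" using r by auto
  then have "degree p = degree ?m + degree r"
    using r nz by (simp add: degree_mult_eq)
  then have "degree r = 0"
    using assms(4) degree_prod_linear[of W] by simp
  moreover have "lead_coeff r = 1"
    using assms(2) r monic_prod_linear[of W] lead_coeff_mult[of ?m r] by simp
  ultimately have "r = 1"
    by (auto elim!: degree_eq_zeroE)
  then show ?thesis using r by simp
qed

section \<open>Words, polynomials and dimension\<close>

lemma coeff_code_poly: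
  "c \<in> carrier_vec n \<Longrightarrow> coeff (code_poly c) i = (if i < n then c $ i else 0)"
  by (auto simp: code_poly_def nth_default_def)

lemma code_poly_vec_coeff:
  assumes "\<And>i. n \<le> i \<Longrightarrow> coeff p i = 0"
  shows "code_poly (vec n (coeff p)) = p"
  using assms by (intro poly_eqI) (auto simp: coeff_code_poly[where n = n])

lemma code_poly_eqD:
  assumes "c \<in> carrier_vec n" "d \<in> carrier_vec n" "code_poly c = code_poly d"
  shows "c = d"
proof (rule eq_vecI)
  fix i assume "i < dim_vec d"
  then show "c $ i = d $ i"
    using assms coeff_code_poly[of c n i] coeff_code_poly[of d n i] by auto
qed (use assms in auto)

lemma degree_code_poly:
  assumes "c \<in> carrier_vec n" "0 < n"
  shows "degree (code_poly c) < n"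
proof (cases "code_poly c = 0")
  case False
  then show ?thesis
    using coeff_code_poly[OF assms(1), of "degree (code_poly c)"] by (auto split: if_splits)
qed (use assms in simp)

text \<open>Coordinates in a basis. The dimension can thus be read off from a count of words, with
  no basis of the code exhibited.\<close>

lemma (in vectorspace) card_carrier_eq_power_dim:
  assumes "finite (carrier V)" "finite (carrier K)"
  shows "card (carrier V) = card (carrier K) ^ dim"
proof -
  \<comment> \<open>The finite carrier is its own spanning set.\<close>
  have "fin_dim"
    unfolding fin_dim_def using assms(1) by (metis subset_refl span_is_subset2 in_own_span subset_antisym)
  then obtain B where B: "finite B" "basis B"
    using finite_basis_exists by blast
  then have BV: "B \<subseteq> carrier V"
    by (simp add: basis_def)
  have ex1: "\<exists>!a. a \<in> B \<rightarrow>\<^sub>E carrier K \<and> lincomb a B = v" if "v \<in> carrier V" for v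
    using basis_criterion[OF B(1) BV] B(2) that by blast
  have "bij_betw (\<lambda>a. lincomb a B) (B \<rightarrow>\<^sub>E carrier K) (carrier V)"
    unfolding bij_betw_def inj_on_def
  proof (intro conjI ballI impI equalityI subsetI)
    have cl: "lincomb a B \<in> carrier V" if "a \<in> B \<rightarrow>\<^sub>E carrier K" for a
      using that BV by (intro lincomb_closed) auto
    then show "v \<in> carrier V" if "v \<in> (\<lambda>a. lincomb a B) ` (B \<rightarrow>\<^sub>E carrier K)" for v
      using that by auto
    show "a = b" if "a \<in> B \<rightarrow>\<^sub>E carrier K" "b \<in> B \<rightarrow>\<^sub>E carrier K" "lincomb a B = lincomb b B" for a b
      using ex1[OF cl[OF that(1)]] that by metis
    show "v \<in> (\<lambda>a. lincomb a B) ` (B \<rightarrow>\<^sub>E carrier K)" if "v \<in> carrier V" for v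
      using ex1[OF that] by blast
  qed
  then have "card (carrier V) = card (B \<rightarrow>\<^sub>E carrier K)"
    by (simp add: bij_betw_same_card)
  also have "\<dots> = card (carrier K) ^ card B"
    using B(1) by (simp add: card_PiE)
  finally show ?thesis
    using dim_basis[OF B] by simp
qed

text \<open>Restriction discards the unspecified values of \<open>$\<close> beyond the length, so
  that vectors can be counted as extensional functions.\<close>

lemma bij_betw_restrict_vec_index:
  "bij_betw (\<lambda>v. restrict (($) v) {..<m}) (carrier_vec m) ({..<m} \<rightarrow>\<^sub>E UNIV)"
  by (rule bij_betw_byWitness[where f' = "vec m"]) (auto simp: restrict_def PiE_def extensional_def)

lemma card_carrier_vec: "card (carrier_vec m :: 'a :: finite vec set) = CARD('a) ^ m"
  using bij_betw_same_card[OF bij_betw_restrict_vec_index[where 'a = 'a]]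
  by (simp add: card_PiE)

lemma finite_carrier_vec: "finite (carrier_vec m :: 'a :: finite vec set)"
  using bij_betw_finite[OF bij_betw_restrict_vec_index[where 'a = 'a]]
  by (simp add: finite_PiE)

section \<open>The Frobenius map and descent to the base field\<close>

text \<open>Closure in one direction suffices: for \<open>q = CARD('a)\<close> the map is injective
  on the extension, hence permutes every finite closed set.\<close>

definition frob_closed :: "nat \<Rightarrow> 'b :: field set \<Rightarrow> bool" where
  "frob_closed q W \<longleftrightarrow> (\<forall>x\<in>W. x ^ q \<in> W)"

locale finite_field_extension = field_hom hom
  for hom :: "'a :: {field, finite} \<Rightarrow> 'b :: field"
begin

sublocale map_poly_hom: map_poly_inj_idom_hom hom ..

lemma frobenius_add: "(x + y :: 'b) ^ CARD('a) = x ^ CARD('a) + y ^ CARD('a)"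
proof -
  let ?q = "CARD('a)"
  define f :: "'a poly" where "f = [:1, 1:] ^ ?q - (monom 1 ?q + 1)"
  have q2: "2 \<le> ?q" by (rule card_field_ge_2)
  \<comment> \<open>The polynomial has degree below q and vanishes on all q elements of the field.\<close>
  have "f = 0"
  proof (rule ccontr)
    assume "f \<noteq> 0"
    have deg: "degree ([:1, 1 :: 'a:] ^ ?q) = ?q"
      by (simp add: degree_power_eq)
    have "coeff ([:1, 1 :: 'a:] ^ ?q) ?q = 1"
      using lead_coeff_power[of "[:1, 1 :: 'a:]" ?q] deg by simp
    then have "coeff f ?q = 0"
      using q2 by (simp add: f_def)
    moreover have "degree f \<le> ?q"
      unfolding f_def using q2 deg
      by (intro degree_diff_le degree_add_le) (auto simp: degree_monom_eq)
    ultimately have "degree f < ?q"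
      using \<open>f \<noteq> 0\<close> by (metis le_neq_implies_less leading_coeff_0_iff)
    moreover have "{a. poly f a = 0} = UNIV"
      by (auto simp: f_def poly_monom finite_field_power_card)
    ultimately show False
      using card_poly_roots_bound[OF \<open>f \<noteq> 0\<close>] by simp
  qed
  \<comment> \<open>As an identity of polynomials it can be moved to the extension and evaluated
    outside the base field, in particular at \<open>x / y\<close>.\<close>
  then have "map_poly hom ([:1, 1:] ^ ?q) = map_poly hom (monom 1 ?q + 1)"
    by (simp add: f_def)
  then have eq: "[:1, 1 :: 'b:] ^ ?q = monom 1 ?q + 1"
    by (simp add: hom_distribs)
  have one: "(z + 1) ^ ?q = z ^ ?q + 1" for z :: 'b
    using arg_cong[OF eq, of "\<lambda>p. poly p z"] by (simp add: poly_monom add.commute)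
  show ?thesis
  proof (cases "y = 0")
    case False
    then have "x + y = (x / y + 1) * y"
      by (simp add: field_simps)
    then have "(x + y) ^ ?q = (x / y + 1) ^ ?q * y ^ ?q"
      by (simp only: power_mult_distrib)
    also have "\<dots> = x ^ ?q + y ^ ?q"
      unfolding one power_divide using False by (simp add: field_simps)
    finally show ?thesis .
  qed (use q2 in \<open>simp add: power_0_left\<close>)
qed

sublocale frob: field_hom "\<lambda>x :: 'b. x ^ CARD('a)"
  by unfold_locales (use card_field_ge_2[where 'a = 'a] in
      \<open>auto simp: frobenius_add power_mult_distrib power_0_left\<close>)

text \<open>The Frobenius map is additive and multiplicative and fixes the coefficients, which come
  from the base field.\<close>

lemma poly_map_poly_frobenius:
  "poly (map_poly hom p) (x ^ CARD('a)) = poly (map_poly hom p) x ^ CARD('a)"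
  by (induction p)
    (auto simp: hom_distribs frobenius_add power_mult_distrib finite_field_power_card
      simp flip: hom_power)

text \<open>X^q - X has at most q roots, and the image of the base field already supplies q of
  them.\<close>

lemma frobenius_fixed_in_range:
  assumes "y ^ CARD('a) = y"
  shows "y \<in> range hom"
proof -
  let ?q = "CARD('a)"
  define f :: "'b poly" where "f = monom 1 ?q - monom 1 1"
  have q2: "2 \<le> ?q" by (rule card_field_ge_2)
  have "coeff f ?q = 1"
    using q2 by (simp add: f_def)
  then have "f \<noteq> 0" by auto
  have "degree f \<le> ?q"
    unfolding f_def using q2 by (intro degree_diff_le) (auto simp: degree_monom_eq)
  have fin: "finite {x. poly f x = 0}"
    by (rule poly_roots_finite[OF \<open>f \<noteq> 0\<close>])
  have sub: "range hom \<subseteq> {x. poly f x = 0}"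
    by (auto simp: f_def poly_monom finite_field_power_card simp flip: hom_power)
  moreover have "card {x. poly f x = 0} \<le> card (range hom)"
    using card_poly_roots_bound[OF \<open>f \<noteq> 0\<close>] \<open>degree f \<le> ?q\<close> card_image[OF inj_f] by simp
  ultimately have "range hom = {x. poly f x = 0}"
    using card_seteq[OF fin] by blast
  then show ?thesis
    using assms by (auto simp: f_def poly_monom)
qed

text \<open>Applying the Frobenius map to the coefficients only permutes the linear factors, so
  every coefficient is fixed and has a preimage under \<open>hom\<close>.\<close>

lemma prod_linear_descends:
  assumes "finite W" "frob_closed CARD('a) W"
  obtains G :: "'a poly" where "map_poly hom G = (\<Prod>x\<in>W. [:- x, 1:])"
proof -
  let ?F = "\<lambda>x :: 'b. x ^ CARD('a)" and ?g = "\<Prod>x\<in>W. [:- x, 1:]"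
  interpret map_frob: map_poly_inj_idom_hom ?F ..
  have "inj_on ?F W"
    using frob.inj_f by (rule inj_on_subset) simp
  moreover have "?F ` W \<subseteq> W"
    using assms(2) by (auto simp: frob_closed_def)
  ultimately have "bij_betw ?F W W"
    using assms(1) endo_inj_surj unfolding bij_betw_def by blast
  then have "?g = (\<Prod>x\<in>W. [:- ?F x, 1:])"
    by (rule prod.reindex_bij_betw[symmetric])
  also have "\<dots> = map_poly ?F ?g"
    by (simp add: map_frob.hom_prod frob.map_poly_pCons_hom frob.hom_uminus)
  finally have eq: "?g = map_poly ?F ?g" .
  have "coeff ?g i \<in> range hom" for i
    by (rule frobenius_fixed_in_range) (metis eq frob.coeff_map_poly_hom)
  then have "map_poly hom (map_poly (inv_into UNIV hom) ?g) = ?g"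
    by (intro poly_eqI) (simp add: coeff_map_poly inv_f_eq[OF inj_f] f_inv_into_f)
  then show ?thesis
    by (rule that)
qed

lemma lead_coeff_eq_1_if_map:
  "lead_coeff (map_poly hom p) = 1 \<Longrightarrow> lead_coeff p = 1"
  by simp

lemma map_poly_dvd_iff: "map_poly hom p dvd map_poly hom r \<longleftrightarrow> p dvd r"
  using dvd_map_poly_hom_imp_dvd map_poly_hom.hom_dvd by blast

lemma frob_closed_roots: "frob_closed CARD('a) {x. poly (map_poly hom p) x = 0}"
  by (simp add: frob_closed_def poly_map_poly_frobenius)

text \<open>The roots of a nonzero base polynomial vanishing at \<open>x\<close> form a
  Frobenius-closed set, which contains \<open>W\<close> by minimality; so \<open>card W\<close>
  bounds its degree from below, and the descended product attains the bound.\<close>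

lemma min_poly_eq:
  assumes fin: "finite W" and "x \<in> W" and cl: "frob_closed CARD('a) W"
    and least: "\<And>U. x \<in> U \<Longrightarrow> frob_closed CARD('a) U \<Longrightarrow> W \<subseteq> U"
  shows "map_poly hom (min_poly hom x) = (\<Prod>y\<in>W. [:- y, 1:])"
proof -
  obtain G :: "'a poly" where G: "map_poly hom G = (\<Prod>y\<in>W. [:- y, 1:])"
    using prod_linear_descends[OF fin cl] .
  have monic: "lead_coeff G = 1"
    using monic_prod_linear[of W] by (intro lead_coeff_eq_1_if_map) (simp only: G)
  have root: "poly (map_poly hom G) x = 0"
    using \<open>x \<in> W\<close> fin unfolding G by (simp add: poly_prod_linear_eq_0_iff)
  have deg: "degree G = card W"
    by (metis G degree_map_poly_hom degree_prod_linear)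
  have min: "degree G \<le> degree r" if "r \<noteq> 0" "poly (map_poly hom r) x = 0" for r
  proof -
    have "W \<subseteq> {y. poly (map_poly hom r) y = 0}"
      using that by (intro least frob_closed_roots) simp
    then have "card W \<le> card {y. poly (map_poly hom r) y = 0}"
      using that by (intro card_mono poly_roots_finite) auto
    also have "\<dots> \<le> degree (map_poly hom r)"
      using that by (intro card_poly_roots_bound) auto
    finally show ?thesis
      using deg by simp
  qed
  have "min_poly hom x = G"
    unfolding min_poly_def
  proof (rule the_equality)
    show "lead_coeff G = 1 \<and> poly (map_poly hom G) x = 0 \<and>
        (\<forall>r. r \<noteq> 0 \<and> poly (map_poly hom r) x = 0 \<longrightarrow> degree G \<le> degree r)"
      using monic root min by blast
    fix p assume p: "lead_coeff p = 1 \<and> poly (map_poly hom p) x = 0 \<and>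
        (\<forall>r. r \<noteq> 0 \<and> poly (map_poly hom r) x = 0 \<longrightarrow> degree p \<le> degree r)"
    have nz: "p \<noteq> 0" "G \<noteq> 0"
      using p monic by auto
    then have degeq: "degree p = degree G"
      using p root min by (meson le_antisym)
    show "p = G"
    proof (rule ccontr)
      assume "p \<noteq> G"
      \<comment> \<open>The difference of two monic candidates still vanishes at \<open>x\<close>,
        but its leading terms cancel, against minimality.\<close>
      have "poly (map_poly hom (p - G)) x = 0"
        using p root by (simp add: map_poly_hom.hom_minus)
      then have "degree G \<le> degree (p - G)"
        using \<open>p \<noteq> G\<close> by (intro min) auto
      moreover have "degree (p - G) \<le> degree G"
        using degeq by (intro degree_diff_le) auto
      ultimately have "degree (p - G) = degree G"
        by simp
      then have "lead_coeff (p - G) = 0"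
        using p monic degeq by simp
      then show False
        using \<open>p \<noteq> G\<close> by (metis leading_coeff_0_iff right_minus_eq)
    qed
  qed
  then show ?thesis
    using G by simp
qed

end

section \<open>Cyclic codes and their zeros\<close>

locale cyclic_codes = finite_field_extension hom
  for hom :: "'a :: {field, finite} \<Rightarrow> 'b :: field" +
  fixes \<alpha> :: 'b and n :: nat
  assumes n_pos: "0 < n" and primitive: "primitive_root_of_unity n \<alpha>"
begin

abbreviation code_eval :: "'a vec \<Rightarrow> 'b \<Rightarrow> 'b" where
  "code_eval c x \<equiv> poly (map_poly hom (code_poly c)) x"

definition unity_roots :: "'b set" where
  "unity_roots = {x. x ^ n = 1}"

text \<open>Injective in \<open>W\<close> on the Frobenius-closed subsets of
  \<open>unity_roots\<close>; without closure, distinct sets may give one code.\<close>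

definition code_of_zeros :: "'b set \<Rightarrow> 'a vec set" where
  "code_of_zeros W = {c \<in> carrier_vec n. \<forall>x\<in>W. code_eval c x = 0}"

lemma map_unity_poly: "map_poly hom (monom 1 n - 1) = monom 1 n - 1"
  by (simp add: hom_distribs)

lemma monic_unity_poly:
  "degree (monom 1 n - 1 :: 'c :: field poly) = n" "lead_coeff (monom 1 n - 1 :: 'c poly) = 1"
proof -
  have "degree (monom 1 n - 1 :: 'c poly) \<le> n"
    by (intro degree_diff_le) (auto simp: degree_monom_eq)
  moreover have c: "coeff (monom 1 n - 1 :: 'c poly) n = 1"
    using n_pos by simp
  ultimately show "degree (monom 1 n - 1 :: 'c poly) = n"
    by (simp add: le_antisym le_degree)
  with c show "lead_coeff (monom 1 n - 1 :: 'c poly) = 1"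
    by simp
qed

lemma unity_roots_eq: "unity_roots = {x. poly (monom 1 n - 1) x = 0}"
  by (simp add: unity_roots_def poly_monom)

lemma finite_unity_roots: "finite unity_roots"
  unfolding unity_roots_eq
  by (intro poly_roots_finite) (metis monic_unity_poly(2) leading_coeff_0_iff zero_neq_one)

lemma alpha_nonzero: "\<alpha> \<noteq> 0"
  using primitive n_pos by (auto simp: primitive_root_of_unity_def power_0_left)

lemma alpha_power_inj: "inj_on (\<lambda>i. \<alpha> ^ i) {..<n}"
proof -
  have "\<not> i < j" if "i < n" "j < n" "\<alpha> ^ i = \<alpha> ^ j" for i j
  proof
    assume "i < j"
    then have "\<alpha> ^ (j - i) = 1"
      using that(3) alpha_nonzero by (simp add: power_diff)
    then show False
      using primitive \<open>i < j\<close> that(2) by (auto simp: primitive_root_of_unity_def)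
  qed
  then show ?thesis
    unfolding inj_on_def by (metis lessThan_iff linorder_neqE_nat)
qed

text \<open>The n distinct powers exhaust the roots of a polynomial of degree n.\<close>

lemma alpha_powers: "(\<lambda>i. \<alpha> ^ i) ` {..<n} = unity_roots"
  and card_unity_roots: "card unity_roots = n"
proof -
  have "(\<alpha> ^ i) ^ n = 1" for i
    using primitive by (metis primitive_root_of_unity_def mult.commute power_mult power_one)
  then have sub: "(\<lambda>i. \<alpha> ^ i) ` {..<n} \<subseteq> unity_roots"
    by (auto simp: unity_roots_def)
  have "card unity_roots \<le> n"
    using card_poly_roots_bound[of "monom 1 n - 1 :: 'b poly"] monic_unity_poly[where 'c = 'b]
    unfolding unity_roots_eq by fastforce
  moreover have "card ((\<lambda>i. \<alpha> ^ i) ` {..<n}) = n"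
    by (simp add: card_image[OF alpha_power_inj])
  ultimately show "(\<lambda>i. \<alpha> ^ i) ` {..<n} = unity_roots"
    using card_seteq[OF finite_unity_roots sub] by simp
  with \<open>card ((\<lambda>i. \<alpha> ^ i) ` {..<n}) = n\<close> show "card unity_roots = n"
    by simp
qed

lemma unity_roots_nonzero: "x \<in> unity_roots \<Longrightarrow> x \<noteq> 0"
  using n_pos by (auto simp: unity_roots_def power_0_left)

lemma inverse_unity_roots: "inverse x \<in> unity_roots \<longleftrightarrow> x \<in> unity_roots"
  by (simp add: unity_roots_def power_inverse)

text \<open>More roots than the degree allows: this is injectivity of the discrete Fourier
  transform.\<close>

lemma vanishing_on_unity_roots:
  fixes p :: "'b poly"
  assumes "\<And>i. n \<le> i \<Longrightarrow> coeff p i = 0" "\<And>x. x \<in> unity_roots \<Longrightarrow> poly p x = 0"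
  shows "p = 0"
proof (rule ccontr)
  assume "p \<noteq> 0"
  then have "degree p < n"
    using assms(1) by (metis leading_coeff_0_iff not_le)
  moreover have "card unity_roots \<le> card {x. poly p x = 0}"
    using assms(2) \<open>p \<noteq> 0\<close> by (intro card_mono poly_roots_finite) auto
  ultimately show False
    using card_poly_roots_bound[OF \<open>p \<noteq> 0\<close>] card_unity_roots by simp
qed

text \<open>The divisor and its cofactor have degrees adding up to n and together account for n
  distinct roots. Neither can have more roots than its degree, so the divisor has exactly as many
  and splits into distinct factors.\<close>

lemma map_poly_divisor_of_unity_poly:
  assumes "lead_coeff g = 1" "g dvd monom 1 n - 1"
  defines "W \<equiv> {x. poly (map_poly hom g) x = 0}"
  shows "W \<subseteq> unity_roots" "frob_closed CARD('a) W" "map_poly hom g = (\<Prod>x\<in>W. [:- x, 1:])"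
proof -
  obtain h where h: "monom 1 n - 1 = g * h"
    using assms(2) by (elim dvdE)
  have nz: "g \<noteq> 0" "h \<noteq> 0"
    using h assms(1) monic_unity_poly(2)[where 'c = 'a] by auto
  have hb: "monom 1 n - 1 = map_poly hom g * map_poly hom h"
    using arg_cong[OF h, of "map_poly hom"] map_unity_poly by (simp add: map_poly_hom.hom_mult)
  have deg: "degree g + degree h = n"
    using degree_mult_eq[OF nz] monic_unity_poly(1)[where 'c = 'a] h by simp
  let ?V = "{x. poly (map_poly hom h) x = 0}"
  have split: "unity_roots = W \<union> ?V"
    unfolding unity_roots_eq hb W_def by auto
  then show "W \<subseteq> unity_roots"
    by simp
  show "frob_closed CARD('a) W"
    unfolding W_def by (rule frob_closed_roots)
  have "card W \<le> degree g" "card ?V \<le> degree h"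
    using card_poly_roots_bound[of "map_poly hom g"] card_poly_roots_bound[of "map_poly hom h"] nz
    by (auto simp: W_def)
  moreover have "n \<le> card W + card ?V"
    using card_Un_le[of W ?V] split card_unity_roots by simp
  ultimately have "card W = degree g"
    using deg by simp
  then show "map_poly hom g = (\<Prod>x\<in>W. [:- x, 1:])"
    using nz(1) assms(1) unfolding W_def
    by (intro monic_eq_prod_linear poly_roots_finite) auto
qed

text \<open>Since \<open>g\<close> divides x^n - 1, reduction preserves divisibility by
  \<open>g\<close>; a word has degree below n and is its own remainder. The ideal is therefore the
  set of words divisible by \<open>g\<close>, that is, vanishing on \<open>W\<close>.\<close>

lemma generator_poly_iff:
  assumes W: "W \<subseteq> unity_roots" and g: "map_poly hom g = (\<Prod>x\<in>W. [:- x, 1:])"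
  shows "generator_poly n D g \<longleftrightarrow> D = code_of_zeros W"
proof -
  have fin: "finite W"
    using W finite_unity_roots by (rule finite_subset)
  have "lead_coeff (map_poly hom g) = 1"
    unfolding g by (rule monic_prod_linear)
  then have monic: "lead_coeff g = 1"
    by simp
  have dvd_iff: "g dvd p \<longleftrightarrow> (\<forall>x\<in>W. poly (map_poly hom p) x = 0)" for p
    unfolding map_poly_dvd_iff[symmetric] g by (rule prod_linear_dvd[OF fin])
  have gdvd: "g dvd monom 1 n - 1"
    unfolding dvd_iff map_unity_poly using W by (auto simp: unity_roots_eq)
  have ideal_iff: "(\<exists>a. code_poly c = (a * g) mod (monom 1 n - 1)) \<longleftrightarrow> g dvd code_poly c"
    if "c \<in> carrier_vec n" for c
  proof
    show "g dvd code_poly c" if "\<exists>a. code_poly c = (a * g) mod (monom 1 n - 1)"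
      using that gdvd by (auto intro: dvd_mod)
    show "\<exists>a. code_poly c = (a * g) mod (monom 1 n - 1)" if dvd: "g dvd code_poly c"
    proof -
      obtain a where "code_poly c = g * a"
        using dvd by (elim dvdE)
      moreover have "code_poly c mod (monom 1 n - 1) = code_poly c"
        using degree_code_poly[OF \<open>c \<in> carrier_vec n\<close> n_pos] monic_unity_poly(1)[where 'c = 'a]
        by (intro mod_poly_less) simp
      ultimately show ?thesis
        by (metis mult.commute)
    qed
  qed
  have "{c \<in> carrier_vec n. \<exists>a. code_poly c = (a * g) mod (monom 1 n - 1)} = code_of_zeros W"
    unfolding code_of_zeros_def using ideal_iff dvd_iff by blast
  then show ?thesis
    using monic gdvd by (simp add: generator_poly_def)
qed

lemma generator_poly_imp_code_of_zeros:
  assumes "generator_poly n D g"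
  obtains W where "W \<subseteq> unity_roots" "frob_closed CARD('a) W" "D = code_of_zeros W"
proof -
  have g: "lead_coeff g = 1" "g dvd monom 1 n - 1"
    using assms by (auto simp: generator_poly_def)
  show ?thesis
    using map_poly_divisor_of_unity_poly[OF g] assms generator_poly_iff that by metis
qed

text \<open>The witness is the descended product over \<open>W\<close>, read as a word: it vanishes
  only on \<open>W\<close>, and the missing \<open>x\<close> keeps its degree below n.\<close>

lemma code_of_zeros_separates:
  assumes W: "W \<subseteq> unity_roots" "frob_closed CARD('a) W" and x: "x \<in> unity_roots" "x \<notin> W"
  obtains c where "c \<in> code_of_zeros W" "code_eval c x \<noteq> 0"
proof -
  have fin: "finite W"
    using W(1) finite_unity_roots by (rule finite_subset)
  obtain G :: "'a poly" where G: "map_poly hom G = (\<Prod>x\<in>W. [:- x, 1:])"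
    using prod_linear_descends[OF fin W(2)] .
  have "degree G = card W"
    by (metis G degree_map_poly_hom degree_prod_linear)
  also have "\<dots> < n"
    using psubset_card_mono[OF finite_unity_roots, of W] W(1) x card_unity_roots by auto
  finally have "code_poly (vec n (coeff G)) = G"
    by (intro code_poly_vec_coeff) (simp add: coeff_eq_0)
  moreover have "poly (map_poly hom G) y = 0 \<longleftrightarrow> y \<in> W" for y
    unfolding G by (rule poly_prod_linear_eq_0_iff[OF fin])
  ultimately show ?thesis
    using x(2) by (intro that[of "vec n (coeff G)"]) (auto simp: code_of_zeros_def)
qed

lemma code_of_zeros_eqD:
  assumes "W \<subseteq> unity_roots" "frob_closed CARD('a) W" "V \<subseteq> unity_roots" "frob_closed CARD('a) V"
    and "code_of_zeros W = code_of_zeros V"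
  shows "W = V"
proof -
  have "V' \<subseteq> W'" if W': "W' \<subseteq> unity_roots" "frob_closed CARD('a) W'"
    and V': "V' \<subseteq> unity_roots" "code_of_zeros W' = code_of_zeros V'" for W' V'
  proof (rule subsetI, rule ccontr)
    fix x assume "x \<in> V'" "x \<notin> W'"
    then obtain c where "c \<in> code_of_zeros W'" "code_eval c x \<noteq> 0"
      using code_of_zeros_separates[OF W'] V'(1) by blast
    then show False
      using V'(2) \<open>x \<in> V'\<close> by (auto simp: code_of_zeros_def)
  qed
  then show ?thesis
    using assms by (metis subset_antisym)
qed

section \<open>Cyclic correlation and the zeros of the dual code\<close>

lemma code_eval_sum:
  assumes "c \<in> carrier_vec n"
  shows "code_eval c x = (\<Sum>i<n. hom (c $ i) * x ^ i)"
proof -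
  have "code_eval c x = (\<Sum>i\<le>degree (code_poly c). hom (coeff (code_poly c) i) * x ^ i)"
    by (simp add: poly_altdef)
  also have "\<dots> = (\<Sum>i<n. hom (coeff (code_poly c) i) * x ^ i)"
    using degree_code_poly[OF assms n_pos]
    by (intro sum.mono_neutral_left) (auto simp: coeff_eq_0)
  also have "\<dots> = (\<Sum>i<n. hom (c $ i) * x ^ i)"
    using assms by (simp add: coeff_code_poly)
  finally show ?thesis .
qed

text \<open>At an n-th root of unity exponents count modulo n, so rotating the entries by
  \<open>k\<close> only rescales the value by a power of \<open>x\<close>.\<close>

lemma code_eval_rotate:
  assumes "c \<in> carrier_vec n" "x \<in> unity_roots"
  shows "x ^ k * code_eval (vec n (\<lambda>i. c $ ((k + i) mod n))) x = code_eval c x"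
proof -
  have "x ^ (m mod n) = x ^ m" for m
  proof -
    have "x ^ m = x ^ (n * (m div n) + m mod n)"
      by simp
    also have "\<dots> = x ^ (m mod n)"
      using assms(2) unfolding power_add power_mult by (simp add: unity_roots_def)
    finally show ?thesis ..
  qed
  then have "x ^ k * code_eval (vec n (\<lambda>i. c $ ((k + i) mod n))) x =
      (\<Sum>i<n. hom (c $ ((k + i) mod n)) * x ^ ((k + i) mod n))"
    by (simp add: code_eval_sum sum_distrib_left power_add mult_ac)
  also have "\<dots> = (\<Sum>i<n. hom (c $ i) * x ^ i)"
  proof -
    have "inj_on (\<lambda>i. (k + i) mod n) {..<n}"
    proof (rule inj_onI)
      fix i j assume "i \<in> {..<n}" "j \<in> {..<n}" "(k + i) mod n = (k + j) mod n"
      then have "[i = j] (mod n)"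
        using cong_add_lcancel_nat[of k i j n] by (simp add: cong_def)
      then show "i = j"
        using \<open>i \<in> {..<n}\<close> \<open>j \<in> {..<n}\<close> by (simp add: cong_def)
    qed
    then have "bij_betw (\<lambda>i. (k + i) mod n) {..<n} {..<n}"
      using n_pos unfolding bij_betw_def by (intro conjI endo_inj_surj) auto
    then show ?thesis
      by (rule sum.reindex_bij_betw)
  qed
  finally show ?thesis
    using assms(1) by (simp add: code_eval_sum)
qed

text \<open>The convolution theorem: the term at \<open>j\<close> is a rotation of \<open>c\<close>
  by \<open>j\<close>, which contributes a factor \<open>inverse x ^ j\<close>. Entry
  \<open>k\<close> of the correlation is the inner product of \<open>v\<close> with \<open>c\<close>
  rotated by \<open>k\<close>.\<close>

lemma code_eval_correlation:
  assumes v: "v \<in> carrier_vec n" and c: "c \<in> carrier_vec n" and x: "x \<in> unity_roots"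
  shows "code_eval (vec n (\<lambda>k. \<Sum>j<n. v $ j * c $ ((j + k) mod n))) x =
    code_eval v (inverse x) * code_eval c x"
proof -
  have nz: "x \<noteq> 0"
    using x by (rule unity_roots_nonzero)
  have "code_eval (vec n (\<lambda>k. \<Sum>j<n. v $ j * c $ ((j + k) mod n))) x =
      (\<Sum>k<n. \<Sum>j<n. hom (v $ j) * (hom (c $ ((j + k) mod n)) * x ^ k))"
    by (simp add: code_eval_sum hom_distribs sum_distrib_right mult_ac)
  also have "\<dots> = (\<Sum>j<n. hom (v $ j) * (\<Sum>k<n. hom (c $ ((j + k) mod n)) * x ^ k))"
    by (subst sum.swap) (simp add: sum_distrib_left)
  also have "\<dots> = (\<Sum>j<n. hom (v $ j) * (inverse x ^ j * code_eval c x))"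
  proof (rule sum.cong)
    fix j assume "j \<in> {..<n}"
    have "(\<Sum>k<n. hom (c $ ((j + k) mod n)) * x ^ k) =
        code_eval (vec n (\<lambda>k. c $ ((j + k) mod n))) x"
      by (simp add: code_eval_sum)
    also have "\<dots> = inverse x ^ j * code_eval c x"
      using nz by (simp add: code_eval_rotate[OF c x, of j, symmetric] power_inverse)
    finally show "hom (v $ j) * (\<Sum>k<n. hom (c $ ((j + k) mod n)) * x ^ k) =
        hom (v $ j) * (inverse x ^ j * code_eval c x)"
      by simp
  qed simp
  also have "\<dots> = code_eval v (inverse x) * code_eval c x"
    by (simp add: code_eval_sum[OF v] sum_distrib_right mult.assoc)
  finally show ?thesis .
qed

lemma dual_code_of_zeros:
  assumes W: "W \<subseteq> unity_roots" "frob_closed CARD('a) W"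
  shows "dual_code n (code_of_zeros W) = code_of_zeros {x \<in> unity_roots. inverse x \<notin> W}"
proof (intro equalityI subsetI)
  fix v assume v: "v \<in> dual_code n (code_of_zeros W)"
  then have vc: "v \<in> carrier_vec n"
    by (simp add: dual_code_def)
  have "code_eval v x = 0" if x: "x \<in> unity_roots" "inverse x \<notin> W" for x
  proof -
    \<comment> \<open>A word nonzero at \<open>inverse x\<close>, so that its factor can be
      cancelled from the product formula.\<close>
    obtain c where c: "c \<in> code_of_zeros W" "code_eval c (inverse x) \<noteq> 0"
      using code_of_zeros_separates[OF W] x inverse_unity_roots by metis
    then have cc: "c \<in> carrier_vec n"
      by (simp add: code_of_zeros_def)
    have "(\<Sum>j<n. v $ j * c $ ((j + k) mod n)) = 0" for k
    proof -
      \<comment> \<open>Rotations of \<open>c\<close> stay in the code, hence every entry of the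
        correlation vanishes.\<close>
      let ?d = "vec n (\<lambda>j. c $ ((k + j) mod n))"
      have "code_eval ?d y = 0" if "y \<in> W" for y
        using code_eval_rotate[OF cc, of y k] that W(1) c(1) unity_roots_nonzero[of y]
        by (auto simp: code_of_zeros_def)
      then have "?d \<in> code_of_zeros W"
        by (simp add: code_of_zeros_def)
      then have "v \<bullet> ?d = 0"
        using v by (simp add: dual_code_def)
      then show ?thesis
        by (simp add: scalar_prod_def atLeast0LessThan add.commute)
    qed
    then have "code_eval v x * code_eval c (inverse x) = 0"
      using code_eval_correlation[OF vc cc, of "inverse x"] x inverse_unity_roots
      by (simp add: code_eval_sum)
    then show ?thesis
      using c(2) by simp
  qed
  then show "v \<in> code_of_zeros {x \<in> unity_roots. inverse x \<notin> W}"
    using vc by (simp add: code_of_zeros_def)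
next
  fix v assume v: "v \<in> code_of_zeros {x \<in> unity_roots. inverse x \<notin> W}"
  then have vc: "v \<in> carrier_vec n"
    by (simp add: code_of_zeros_def)
  have "v \<bullet> c = 0" if c: "c \<in> code_of_zeros W" for c
  proof -
    have cc: "c \<in> carrier_vec n"
      using c by (simp add: code_of_zeros_def)
    let ?r = "vec n (\<lambda>k. \<Sum>j<n. v $ j * c $ ((j + k) mod n))"
    \<comment> \<open>Either \<open>x\<close> is a zero of \<open>c\<close>, or
      \<open>inverse x\<close> is a zero of \<open>v\<close>.\<close>
    have "code_eval ?r x = 0" if x: "x \<in> unity_roots" for x
      unfolding code_eval_correlation[OF vc cc x]
      using v c x inverse_unity_roots by (cases "x \<in> W") (auto simp: code_of_zeros_def)
    then have "map_poly hom (code_poly ?r) = 0"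
      by (intro vanishing_on_unity_roots) (simp_all add: coeff_code_poly[where n = n])
    then have "code_poly ?r = 0"
      by simp
    \<comment> \<open>Entry 0 is the unrotated inner product.\<close>
    then have "?r $ 0 = 0"
      using coeff_code_poly[of ?r n 0] n_pos by simp
    then show ?thesis
      using n_pos cc by (simp add: scalar_prod_def atLeast0LessThan)
  qed
  then show "v \<in> dual_code n (code_of_zeros W)"
    using vc by (simp add: dual_code_def)
qed

section \<open>Dimension from the number of zeros\<close>

lemma subspace_code_of_zeros: 
  "VectorSpace.subspace class_ring (code_of_zeros W) (module_vec TYPE('a) n)"
  unfolding VectorSpace.subspace_def
  by (intro conjI submodule.intro vec_vs vec_module)
    (auto simp: code_of_zeros_def module_vec_simps class_ring_simps code_eval_sum hom_distribs
    ring_distribs sum.distrib mult.assoc simp flip: sum_distrib_left)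

text \<open>Multiplication by the generator \<open>G\<close>, of degree \<open>card W\<close>, is a
  bijection from all words of length \<open>n - card W\<close> onto the code.\<close>

lemma card_code_of_zeros:
  assumes W: "W \<subseteq> unity_roots" "frob_closed CARD('a) W"
  shows "card (code_of_zeros W) = CARD('a) ^ (n - card W)"
proof -
  have fin: "finite W"
    using W(1) finite_unity_roots by (rule finite_subset)
  obtain G :: "'a poly" where G: "map_poly hom G = (\<Prod>x\<in>W. [:- x, 1:])"
    using prod_linear_descends[OF fin W(2)] .
  have "G \<noteq> 0"
    using monic_prod_linear[of W] G by auto
  have deg: "degree G = card W"
    by (metis G degree_map_poly_hom degree_prod_linear)
  have dvd_iff: "G dvd p \<longleftrightarrow> (\<forall>x\<in>W. poly (map_poly hom p) x = 0)" for p
    unfolding map_poly_dvd_iff[symmetric] G by (rule prod_linear_dvd[OF fin])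
  let ?m = "n - card W"
  have le: "card W \<le> n"
    using card_mono[OF finite_unity_roots W(1)] card_unity_roots by simp
  define mul where "mul v = vec n (coeff (code_poly v * G))" for v :: "'a vec"
  have code_mul: "code_poly (mul v) = code_poly v * G" if "v \<in> carrier_vec ?m" for v
    unfolding mul_def
  proof (intro code_poly_vec_coeff)
    fix i assume "n \<le> i"
    show "coeff (code_poly v * G) i = 0"
    proof (cases "code_poly v = 0")
      case False
      \<comment> \<open>A word of length 0 has zero polynomial; the strict degree bound for words
        requires positive length.\<close>
      then have "0 < ?m"
        using coeff_code_poly[OF that] by (metis gr0I leading_coeff_0_iff not_less0)
      then have "degree (code_poly v) < ?m"
        using degree_code_poly[OF that] by simp
      then have "degree (code_poly v * G) < n"
        using degree_mult_le[of "code_poly v" G] deg by simp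
      then show ?thesis
        using \<open>n \<le> i\<close> by (simp add: coeff_eq_0)
    qed simp
  qed
  have "bij_betw mul (carrier_vec ?m) (code_of_zeros W)"
    unfolding bij_betw_def
  proof (intro conjI inj_onI equalityI subsetI)
    fix u v assume "u \<in> carrier_vec ?m" "v \<in> carrier_vec ?m" "mul u = mul v"
    then show "u = v"
      using code_mul[of u] code_mul[of v] \<open>G \<noteq> 0\<close> by (intro code_poly_eqD[of _ ?m]) auto
  next
    fix c assume "c \<in> mul ` carrier_vec ?m"
    then obtain v where v: "v \<in> carrier_vec ?m" "c = mul v"
      by blast
    then have "G dvd code_poly c"
      using code_mul by simp
    then show "c \<in> code_of_zeros W"
      unfolding dvd_iff using v by (simp add: code_of_zeros_def mul_def)
  next
    fix c assume c: "c \<in> code_of_zeros W"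
    then have cc: "c \<in> carrier_vec n"
      by (simp add: code_of_zeros_def)
    have "G dvd code_poly c"
      unfolding dvd_iff using c by (simp add: code_of_zeros_def)
    then obtain r where r: "code_poly c = G * r"
      by (elim dvdE)
    have "code_poly (vec ?m (coeff r)) = r"
    proof (rule code_poly_vec_coeff)
      fix i assume "?m \<le> i"
      show "coeff r i = 0"
      proof (cases "r = 0")
        case False
        then have "degree G + degree r < n"
          using degree_code_poly[OF cc n_pos] r \<open>G \<noteq> 0\<close> by (simp add: degree_mult_eq)
        then show ?thesis
          using \<open>?m \<le> i\<close> deg by (intro coeff_eq_0) simp
      qed simp
    qed
    then have "mul (vec ?m (coeff r)) = c"
      using r code_mul[of "vec ?m (coeff r)"] cc
      by (intro code_poly_eqD[of _ n]) (auto simp: mul_def mult.commute)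
    then show "c \<in> mul ` carrier_vec ?m"
      by (metis imageI vec_carrier)
  qed
  then show ?thesis
    using bij_betw_same_card card_carrier_vec by metis
qed

lemma dim_code_of_zeros:
  assumes W: "W \<subseteq> unity_roots" "frob_closed CARD('a) W"
  shows "vectorspace.dim class_ring ((module_vec TYPE('a) n)\<lparr>carrier := code_of_zeros W\<rparr>) =
    n - card W"
proof -
  interpret V: vectorspace "class_ring :: 'a ring" "(module_vec TYPE('a) n)\<lparr>carrier := code_of_zeros W\<rparr>"
    by (rule vectorspace.subspace_is_vs[OF vec_vs subspace_code_of_zeros])
  have "code_of_zeros W \<subseteq> carrier_vec n"
    by (auto simp: code_of_zeros_def)
  then have "finite (code_of_zeros W)"
    using finite_carrier_vec by (rule finite_subset)
  then have "CARD('a) ^ V.dim = CARD('a) ^ (n - card W)"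
    using V.card_carrier_eq_power_dim card_code_of_zeros[OF W] by (simp add: class_ring_simps)
  then show ?thesis
    using card_field_ge_2[where 'a = 'a] by (simp add: power_inject_exp)
qed

end

section \<open>Cyclotomic cosets and Frobenius orbits\<close>

text \<open>Pigeonhole: two powers of \<open>q\<close> agree modulo \<open>n\<close>, and the
  smaller one cancels by coprimality.\<close>

lemma coprime_power_cong_1:
  fixes n q :: nat
  assumes "0 < n" "coprime n q"
  obtains d where "0 < d" "[q ^ d = 1] (mod n)"
proof -
  have "finite (range (\<lambda>j. q ^ j mod n))"
    by (rule finite_subset[of _ "{..<n}"]) (use assms(1) in auto)
  then have "\<not> inj (\<lambda>j. q ^ j mod n)"
    using range_inj_infinite by blast
  then obtain i j where ij: "i < j" "[q ^ i = q ^ j] (mod n)"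
    unfolding inj_def cong_def by (metis linorder_neqE_nat)
  then have "[q ^ i * 1 = q ^ i * q ^ (j - i)] (mod n)"
    by (simp flip: power_add)
  moreover have "coprime (q ^ i) n"
    using assms(2) by (simp add: coprime_commute)
  ultimately have "[q ^ (j - i) = 1] (mod n)"
    by (metis cong_mult_lcancel_nat cong_sym)
  then show ?thesis
    using ij(1) by (intro that[of "j - i"]) auto
qed

text \<open>Coprimality provides an exponent that returns to \<open>a\<close>, so the
  \<open>LEAST\<close> in \<open>coset_size\<close> is attained and exponents may be reduced modulo
  it.\<close>

lemma cyclotomic_coset_eq_range:
  assumes "0 < n" "coprime n q"
  shows "cyclotomic_coset q n a = range (\<lambda>j. (a * int q ^ j) mod int n)"
proof -
  let ?d = "coset_size q n a"
  obtain e where "0 < e" "[q ^ e = 1] (mod n)"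
    using coprime_power_cong_1[OF assms] .
  then have "[int q ^ e = 1] (mod int n)"
    by (metis cong_int_iff of_nat_1 of_nat_power)
  then have "[a * int q ^ e = a * 1] (mod int n)"
    by (intro cong_mult cong_refl)
  with \<open>0 < e\<close> have d: "0 < ?d" "[a * int q ^ ?d = a] (mod int n)"
    using LeastI[of "\<lambda>d. 0 < d \<and> (a * int q ^ d) mod int n = a mod int n" e]
    by (auto simp: coset_size_def cong_def)
  have mult: "[a * int q ^ (?d * k) = a] (mod int n)" for k
  proof (induction k)
    case (Suc k)
    have "[a * int q ^ ?d * int q ^ (?d * k) = a * int q ^ (?d * k)] (mod int n)"
      using d(2) by (intro cong_mult cong_refl)
    with Suc show ?case
      by (metis cong_trans mult.assoc mult_Suc_right power_add)
  qed simp
  have "(a * int q ^ j) mod int n \<in> cyclotomic_coset q n a" for j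
  proof -
    have "[a * int q ^ (?d * (j div ?d)) * int q ^ (j mod ?d) = a * int q ^ (j mod ?d)] (mod int n)"
      using mult by (intro cong_mult cong_refl)
    then have "(a * int q ^ j) mod int n = (a * int q ^ (j mod ?d)) mod int n"
      by (simp add: cong_def mult.assoc flip: power_add)
    then show ?thesis
      using d(1) by (simp add: cyclotomic_coset_def)
  qed
  then show ?thesis
    by (auto simp: cyclotomic_coset_def)
qed

text \<open>The conjugates of \<open>x\<close>: the multiplicative counterpart of a cyclotomic
  coset.\<close>

definition frob_orbit :: "nat \<Rightarrow> 'b :: field \<Rightarrow> 'b set" where
  "frob_orbit q x = range (\<lambda>j. x ^ (q ^ j))"

lemma frob_orbit_self: "x \<in> frob_orbit q x"
  unfolding frob_orbit_def by (rule range_eqI[of _ _ 0]) simp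

lemma frob_closed_orbit: "frob_closed q (frob_orbit q x)"
  unfolding frob_closed_def frob_orbit_def
proof
  fix y assume "y \<in> range (\<lambda>j. x ^ (q ^ j))"
  then obtain j where "y = x ^ (q ^ j)"
    by blast
  then have "y ^ q = x ^ (q ^ Suc j)"
    by (metis power_Suc2 power_mult)
  then show "y ^ q \<in> range (\<lambda>j. x ^ (q ^ j))"
    by blast
qed

lemma frob_orbit_subset:
  assumes "x \<in> U" "frob_closed q U"
  shows "frob_orbit q x \<subseteq> U"
proof -
  have "x ^ (q ^ j) \<in> U" for j
  proof (induction j)
    case (Suc j)
    then have "(x ^ q ^ j) ^ q \<in> U"
      using assms(2) unfolding frob_closed_def by blast
    then show ?case
      by (metis power_Suc2 power_mult)
  qed (simp add: assms(1))
  then show ?thesis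
    by (auto simp: frob_orbit_def)
qed

lemma frob_orbit_inverse: "y \<in> frob_orbit q x \<Longrightarrow> inverse y \<in> frob_orbit q (inverse x)"
  by (auto simp: frob_orbit_def power_inverse)

section \<open>Frobenius orbits on the roots of unity\<close>

locale cyclic_codes_coprime = cyclic_codes hom \<alpha> n
  for hom :: "'a :: {field, finite} \<Rightarrow> 'b :: field" and \<alpha> n +
  assumes coprime: "coprime n CARD('a)"
begin

lemma frob_closed_unity_roots: "frob_closed k unity_roots"
  unfolding frob_closed_def
proof
  fix x assume "x \<in> unity_roots"
  then have "(x ^ n) ^ k = 1"
    by (simp add: unity_roots_def)
  then show "x ^ k \<in> unity_roots"
    unfolding unity_roots_def by (simp only: mem_Collect_eq power_mult[symmetric] mult.commute)
qed

lemma orbit_subset_unity_roots: "x \<in> unity_roots \<Longrightarrow> frob_orbit CARD('a) x \<subseteq> unity_roots"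
  using frob_closed_unity_roots by (rule frob_orbit_subset[rotated])

text \<open>The Frobenius map is periodic on roots of unity: if q^d is 1 modulo n, then
  \<open>d * j - j\<close> further steps lead from \<open>y\<close> back to
  \<open>x\<close>.\<close>

lemma orbit_eq:
  assumes "x \<in> unity_roots" "y \<in> frob_orbit CARD('a) x"
  shows "frob_orbit CARD('a) y = frob_orbit CARD('a) x"
proof -
  obtain j where y: "y = x ^ (CARD('a) ^ j)"
    using assms(2) by (auto simp: frob_orbit_def)
  obtain d where d: "0 < d" "[CARD('a) ^ d = 1] (mod n)"
    using coprime_power_cong_1[OF n_pos coprime] .
  have "[CARD('a) ^ (d * j) = 1] (mod n)"
    using cong_pow[OF d(2), of j] by (simp add: power_mult)
  then have "(CARD('a) ^ (d * j)) mod n = 1 mod n"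
    by (simp add: cong_def)
  moreover have "x ^ m = x ^ (m mod n)" for m
  proof -
    have "x ^ n = 1"
      using assms(1) by (simp add: unity_roots_def)
    have "x ^ m = x ^ (n * (m div n) + m mod n)"
      by (simp only: mult_div_mod_eq)
    also have "\<dots> = x ^ (m mod n)"
      by (simp only: power_add power_mult \<open>x ^ n = 1\<close> power_one mult_1_left)
    finally show ?thesis .
  qed
  ultimately have "x ^ (CARD('a) ^ (d * j)) = x"
    by (metis power_one_right)
  \<comment> \<open>Since \<open>d\<close> is positive, the subtraction on naturals is not
    truncated.\<close>
  moreover have "j + (d * j - j) = d * j"
    using d(1) by simp
  ultimately have "y ^ (CARD('a) ^ (d * j - j)) = x"
    unfolding y by (simp only: power_mult[symmetric] power_add[symmetric])
  then have "x \<in> frob_orbit CARD('a) y"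
    unfolding frob_orbit_def by (metis rangeI)
  then show ?thesis
    using assms(2) by (intro subset_antisym frob_orbit_subset frob_closed_orbit)
qed

lemma alpha_powi_mod: "\<alpha> powi (m mod int n) = \<alpha> powi m"
proof -
  have "\<alpha> ^ n = 1"
    using primitive by (simp add: primitive_root_of_unity_def)
  have "\<alpha> powi m = \<alpha> powi (int n * (m div int n) + m mod int n)"
    by (simp only: mult_div_mod_eq)
  also have "\<dots> = \<alpha> powi (m mod int n)"
    by (simp only: power_int_add[OF disjI1[OF alpha_nonzero]] power_int_mult power_int_of_nat
        \<open>\<alpha> ^ n = 1\<close> power_int_1_left mult_1_left)
  finally show ?thesis ..
qed

lemma alpha_powi_image_coset:
  "(\<lambda>s. \<alpha> powi s) ` cyclotomic_coset CARD('a) n a = frob_orbit CARD('a) (\<alpha> powi a)"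
proof -
  have "\<alpha> powi (a * int CARD('a) ^ j) = (\<alpha> powi a) ^ (CARD('a) ^ j)" for j
    by (simp only: power_int_mult of_nat_power[symmetric] power_int_of_nat)
  then show ?thesis
    unfolding cyclotomic_coset_eq_range[OF n_pos coprime] frob_orbit_def
    by (simp add: image_image alpha_powi_mod)
qed

lemma alpha_powi_inj: "inj_on (\<lambda>s. \<alpha> powi s) {0..<int n}"
proof (rule inj_onI)
  fix i j assume ij: "i \<in> {0..<int n}" "j \<in> {0..<int n}" "\<alpha> powi i = \<alpha> powi j"
  then have "\<alpha> ^ nat i = \<alpha> ^ nat j"
    by (simp add: power_int_def)
  then have "nat i = nat j"
    using ij by (intro inj_onD[OF alpha_power_inj]) auto
  then show "i = j"
    using ij(1,2) by (metis atLeastLessThan_iff nat_0_le)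
qed

lemma coset_subset: "cyclotomic_coset CARD('a) n a \<subseteq> {0..<int n}"
  using n_pos by (auto simp: cyclotomic_coset_eq_range[OF n_pos coprime])

lemma card_coset:
  "card (cyclotomic_coset CARD('a) n a) = card (frob_orbit CARD('a) (\<alpha> powi a))"
  unfolding alpha_powi_image_coset[symmetric]
  using inj_on_subset[OF alpha_powi_inj coset_subset] by (simp add: card_image)

lemma mem_coset_iff:
  assumes "k \<in> {0..<int n}"
  shows "k \<in> cyclotomic_coset CARD('a) n a \<longleftrightarrow> \<alpha> powi k \<in> frob_orbit CARD('a) (\<alpha> powi a)"
  unfolding alpha_powi_image_coset[symmetric]
  using inj_on_image_mem_iff[OF alpha_powi_inj assms coset_subset] by simp

lemma alpha_powi_unity_root: "\<alpha> powi a \<in> unity_roots"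
proof -
  have "\<alpha> powi a = \<alpha> powi int (nat (a mod int n))"
    using n_pos by (simp add: alpha_powi_mod)
  also have "\<dots> = \<alpha> ^ nat (a mod int n)"
    by (rule power_int_of_nat)
  also have "\<dots> \<in> unity_roots"
    unfolding alpha_powers[symmetric] using n_pos by (intro imageI) (simp add: nat_less_iff)
  finally show ?thesis .
qed

lemma map_min_poly:
  assumes "x \<in> unity_roots"
  shows "map_poly hom (min_poly hom x) = (\<Prod>y\<in>frob_orbit CARD('a) x. [:- y, 1:])"
proof (rule min_poly_eq)
  show "finite (frob_orbit CARD('a) x)"
    using orbit_subset_unity_roots[OF assms] finite_unity_roots by (rule finite_subset)
qed (fact frob_orbit_self frob_closed_orbit frob_orbit_subset)+

section \<open>Coset leaders and basic dual zeros\<close>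

context
  fixes L :: "int set"
  assumes L: "coset_leaders CARD('a) n L"
begin

lemma leaders_subset: "L \<subseteq> {0..<int n}"
  using L by (simp add: coset_leaders_def)

lemma leader_exists:
  assumes "x \<in> unity_roots"
  obtains i where "i \<in> L" "\<alpha> powi i \<in> frob_orbit CARD('a) x"
proof -
  obtain m where m: "x = \<alpha> ^ m"
    using assms alpha_powers by auto
  obtain i where i: "i \<in> L" "i \<in> cyclotomic_coset CARD('a) n (int m)"
    using L unfolding coset_leaders_def by blast
  then have "\<alpha> powi i \<in> frob_orbit CARD('a) (\<alpha> powi int m)"
    using mem_coset_iff leaders_subset by blast
  then show ?thesis
    using that i(1) m by simp
qed

lemma leader_unique:
  assumes "i \<in> L" "k \<in> L" "x \<in> unity_roots"
    and "\<alpha> powi i \<in> frob_orbit CARD('a) x" "\<alpha> powi k \<in> frob_orbit CARD('a) x"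
  shows "i = k"
proof -
  obtain m where "x = \<alpha> powi int m"
    using assms(3) alpha_powers by auto
  then have "i \<in> cyclotomic_coset CARD('a) n (int m)" "k \<in> cyclotomic_coset CARD('a) n (int m)"
    using assms mem_coset_iff leaders_subset by blast+
  then show ?thesis
    using L assms(1,2) unfolding coset_leaders_def by blast
qed

lemma orbits_disjoint:
  assumes "i \<in> L" "k \<in> L" "i \<noteq> k"
  shows "frob_orbit CARD('a) (\<alpha> powi i) \<inter> frob_orbit CARD('a) (\<alpha> powi k) = {}"
  using assms leader_unique[OF assms(1,2) alpha_powi_unity_root[of i] frob_orbit_self]
    orbit_eq[OF alpha_powi_unity_root] frob_orbit_self
  by (metis disjoint_iff)

lemma finite_leaders: "finite L"
  using leaders_subset finite_subset by blast

lemma finite_orbit: "finite (frob_orbit CARD('a) (\<alpha> powi i))"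
  using orbit_subset_unity_roots[OF alpha_powi_unity_root] finite_unity_roots
  by (rule finite_subset)

lemma map_prod_min_poly:
  assumes "S \<subseteq> L"
  shows "map_poly hom (\<Prod>i\<in>S. min_poly hom (\<alpha> powi i)) =
    (\<Prod>y\<in>(\<Union>i\<in>S. frob_orbit CARD('a) (\<alpha> powi i)). [:- y, 1:])"
proof -
  have "(\<Prod>y\<in>(\<Union>i\<in>S. frob_orbit CARD('a) (\<alpha> powi i)). [:- y, 1:]) =
      (\<Prod>i\<in>S. \<Prod>y\<in>frob_orbit CARD('a) (\<alpha> powi i). [:- y, 1:])"
    using assms finite_subset[OF assms finite_leaders] orbits_disjoint finite_orbit
    by (intro prod.UNION_disjoint) blast+
  then show ?thesis
    by (simp add: map_poly_hom.hom_prod map_min_poly[OF alpha_powi_unity_root])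
qed

lemma union_orbits_leaders:
  assumes "W \<subseteq> unity_roots" "frob_closed CARD('a) W"
  shows "(\<Union>i\<in>{i\<in>L. \<alpha> powi i \<in> W}. frob_orbit CARD('a) (\<alpha> powi i)) = W"
proof (intro equalityI subsetI)
  fix x assume "x \<in> W"
  then have x: "x \<in> unity_roots"
    using assms(1) by blast
  obtain i where i: "i \<in> L" "\<alpha> powi i \<in> frob_orbit CARD('a) x"
    using leader_exists[OF x] .
  then have "\<alpha> powi i \<in> W" "x \<in> frob_orbit CARD('a) (\<alpha> powi i)"
    using frob_orbit_subset[OF \<open>x \<in> W\<close> assms(2)] orbit_eq[OF x i(2)] frob_orbit_self by blast+
  then show "x \<in> (\<Union>i\<in>{i\<in>L. \<alpha> powi i \<in> W}. frob_orbit CARD('a) (\<alpha> powi i))"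
    using i(1) by blast
qed (use assms(2) frob_orbit_subset in blast)

text \<open>A code determines its zero set, so a product over \<open>S\<close> generates it iff
  \<open>W\<close> is the union of the orbits of \<open>S\<close>. Each orbit has one leader, so
  \<open>S\<close> must consist of the leaders lying in \<open>W\<close>; this makes the
  \<open>THE\<close> well defined.\<close>

lemma basic_dual_zero_code_of_zeros:
  assumes W: "W \<subseteq> unity_roots" "frob_closed CARD('a) W"
  shows "basic_dual_zero hom \<alpha> n L (code_of_zeros W) = W \<inter> (\<lambda>i. \<alpha> powi i) ` L"
proof -
  have gen_iff: "generator_poly n (code_of_zeros W) (\<Prod>i\<in>S. min_poly hom (\<alpha> powi i)) \<longleftrightarrow>
      W = (\<Union>i\<in>S. frob_orbit CARD('a) (\<alpha> powi i))" (is "_ \<longleftrightarrow> W = ?U") if S: "S \<subseteq> L" for S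
  proof -
    have U: "?U \<subseteq> unity_roots" "frob_closed CARD('a) ?U"
      using orbit_subset_unity_roots[OF alpha_powi_unity_root] frob_closed_orbit
      unfolding frob_closed_def by blast+
    show ?thesis
      using generator_poly_iff[OF U(1) map_prod_min_poly[OF S]] code_of_zeros_eqD[OF W U] by blast
  qed
  have eq: "(\<lambda>i. \<alpha> powi i) ` S = W \<inter> (\<lambda>i. \<alpha> powi i) ` L"
    if S: "S \<subseteq> L" and WS: "W = (\<Union>i\<in>S. frob_orbit CARD('a) (\<alpha> powi i))" for S
  proof (intro equalityI subsetI)
    fix x assume "x \<in> W \<inter> (\<lambda>i. \<alpha> powi i) ` L"
    then obtain i k where ik: "i \<in> S" "k \<in> L" "x = \<alpha> powi k"
      "\<alpha> powi k \<in> frob_orbit CARD('a) (\<alpha> powi i)"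
      using WS by auto
    then have "i = k"
      using S frob_orbit_self leader_unique[OF _ _ alpha_powi_unity_root] by blast
    then show "x \<in> (\<lambda>i. \<alpha> powi i) ` S"
      using ik by blast
  qed (use S WS frob_orbit_self in blast)
  show ?thesis
    unfolding basic_dual_zero_def
  proof (rule the_equality)
    show "\<exists>S\<subseteq>L. generator_poly n (code_of_zeros W) (\<Prod>i\<in>S. min_poly hom (\<alpha> powi i)) \<and>
        W \<inter> (\<lambda>i. \<alpha> powi i) ` L = (\<lambda>i. \<alpha> powi i) ` S"
      using gen_iff union_orbits_leaders[OF W]
      by (intro exI[of _ "{i\<in>L. \<alpha> powi i \<in> W}"]) auto
  qed (use gen_iff eq in blast)
qed

lemma card_frob_closed:
  assumes W: "W \<subseteq> unity_roots" "frob_closed CARD('a) W"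
  shows "card W = (\<Sum>i\<in>{i\<in>L. \<alpha> powi i \<in> W}. card (cyclotomic_coset CARD('a) n i))"
proof -
  have "card W = card (\<Union>i\<in>{i\<in>L. \<alpha> powi i \<in> W}. frob_orbit CARD('a) (\<alpha> powi i))"
    by (simp only: union_orbits_leaders[OF W])
  also have "\<dots> = (\<Sum>i\<in>{i\<in>L. \<alpha> powi i \<in> W}. card (frob_orbit CARD('a) (\<alpha> powi i)))"
    using finite_leaders finite_orbit orbits_disjoint by (intro card_UN_disjoint) auto
  finally show ?thesis
    by (simp add: card_coset)
qed

section \<open>Zeros and dimension of the hull\<close>

lemma basic_dual_zero_hull:
  assumes gen: "generator_poly n C g"
    and BZ: "basic_dual_zero hom \<alpha> n L (dual_code n C) = T1 \<union> T2" and disj: "T1 \<inter> T2 = {}"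
    and T1: "\<And>i. i \<in> L \<Longrightarrow> \<alpha> powi i \<in> T1 \<Longrightarrow>
      cyclotomic_coset CARD('a) n i = cyclotomic_coset CARD('a) n (- i) \<or>
      (\<exists>k\<in>L. k \<in> cyclotomic_coset CARD('a) n (- i) \<and> \<alpha> powi k \<in> T1)"
    and T2: "\<And>i. i \<in> L \<Longrightarrow> \<alpha> powi i \<in> T2 \<Longrightarrow>
      \<not> (\<exists>k\<in>L. k \<in> cyclotomic_coset CARD('a) n (- i) \<and> \<alpha> powi k \<in> T2)"
  shows "basic_dual_zero hom \<alpha> n L (dual_code n (hull_code n C)) = T2"
    and "hull_dim n C = (\<Sum>i\<in>{i\<in>L. \<alpha> powi i \<in> T2}. card (cyclotomic_coset CARD('a) n i))"
proof -
  let ?T = "(\<lambda>i. \<alpha> powi i) ` L"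
  obtain Z where Z: "Z \<subseteq> unity_roots" "frob_closed CARD('a) Z" and C: "C = code_of_zeros Z"
    using generator_poly_imp_code_of_zeros[OF gen] .
  define D where "D = {x \<in> unity_roots. inverse x \<notin> Z}"
  define R where "R = {x \<in> unity_roots. inverse x \<notin> Z \<union> D}"
  have closed: "frob_closed CARD('a) {x \<in> unity_roots. inverse x \<notin> W}"
    if W: "W \<subseteq> unity_roots" "frob_closed CARD('a) W" for W
    unfolding frob_closed_def
  proof (safe)
    fix x assume x: "x \<in> unity_roots" "inverse x \<notin> W"
    then show "x ^ CARD('a) \<in> unity_roots"
      using frob_closed_unity_roots by (simp add: frob_closed_def)
    assume "inverse (x ^ CARD('a)) \<in> W"
    \<comment> \<open>Closure only moves forward; going on along the orbit of the inverse returns to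
      \<open>inverse x\<close>.\<close>
    moreover have "inverse (x ^ CARD('a)) \<in> frob_orbit CARD('a) (inverse x)"
      using frob_closed_orbit frob_orbit_self unfolding frob_closed_def by (metis power_inverse)
    then have "inverse x \<in> frob_orbit CARD('a) (inverse (x ^ CARD('a)))"
      using orbit_eq x(1) inverse_unity_roots frob_orbit_self by metis
    ultimately show False
      using frob_orbit_subset W(2) x(2) by blast
  qed
  have D: "D \<subseteq> unity_roots" "frob_closed CARD('a) D"
    using closed[OF Z] by (auto simp: D_def)
  have ZD: "Z \<union> D \<subseteq> unity_roots" "frob_closed CARD('a) (Z \<union> D)"
    using Z D by (auto simp: frob_closed_def)
  have R: "R \<subseteq> unity_roots" "frob_closed CARD('a) R"
    using closed[OF ZD] by (auto simp: R_def)
  have dual: "dual_code n C = code_of_zeros D"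
    unfolding C D_def by (rule dual_code_of_zeros[OF Z])
  have hull: "hull_code n C = code_of_zeros (Z \<union> D)"
    unfolding hull_code_def dual unfolding C by (auto simp: code_of_zeros_def)
  have dual_hull: "dual_code n (hull_code n C) = code_of_zeros R"
    unfolding hull R_def by (rule dual_code_of_zeros[OF ZD])
  have DT: "D \<inter> ?T = T1 \<union> T2"
    using BZ basic_dual_zero_code_of_zeros[OF D] dual by simp
  \<comment> \<open>For a root of unity \<open>x\<close>, \<open>inverse x \<notin> Z\<close> is
    precisely \<open>x \<in> D\<close>.\<close>
  have R_iff: "x \<in> R \<longleftrightarrow> x \<in> D \<and> inverse x \<notin> D" for x
    by (auto simp: R_def D_def inverse_unity_roots)
  have coset_neg: "k \<in> cyclotomic_coset CARD('a) n (- i) \<longleftrightarrow>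
      \<alpha> powi k \<in> frob_orbit CARD('a) (inverse (\<alpha> powi i))" if "k \<in> L" for i k
    using mem_coset_iff that leaders_subset by (auto simp: power_int_minus)
  have inverse_root: "inverse (\<alpha> powi i) \<in> unity_roots" for i
    by (simp add: inverse_unity_roots alpha_powi_unity_root)
  have RT: "R \<inter> ?T = T2"
  proof (intro equalityI subsetI)
    fix x assume x: "x \<in> R \<inter> ?T"
    then obtain i where i: "i \<in> L" "x = \<alpha> powi i"
      by blast
    have "x \<notin> T1"
    proof
      assume "x \<in> T1"
      then consider "cyclotomic_coset CARD('a) n i = cyclotomic_coset CARD('a) n (- i)"
        | k where "k \<in> L" "k \<in> cyclotomic_coset CARD('a) n (- i)" "\<alpha> powi k \<in> T1"
        using T1 i by blast
      then have "inverse x \<in> D"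
      proof cases
        \<comment> \<open>\<open>inverse x\<close> lies in the orbit of \<open>x\<close>, hence in
          the closed set \<open>D\<close>.\<close>
        case 1
        then have "frob_orbit CARD('a) x = frob_orbit CARD('a) (inverse x)"
          using alpha_powi_image_coset[of i] alpha_powi_image_coset[of "- i"] i(2)
          by (simp add: power_int_minus)
        then show ?thesis
          using frob_orbit_self frob_orbit_subset[OF _ D(2), of x] x R_iff by blast
      next
        \<comment> \<open>The leader \<open>k\<close> of the inverse orbit belongs to T1, hence to
          \<open>D\<close>, and closure carries this to \<open>inverse x\<close>.\<close>
        case 2
        then have "inverse x \<in> frob_orbit CARD('a) (\<alpha> powi k)"
          using coset_neg orbit_eq[OF inverse_root] frob_orbit_self i(2) by metis
        then show ?thesis
          using frob_orbit_subset[OF _ D(2), of "\<alpha> powi k"] 2 DT by blast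
      qed
      then show False
        using x R_iff by blast
    qed
    then show "x \<in> T2"
      using x R_iff DT by blast
  next
    fix x assume x: "x \<in> T2"
    then obtain i where i: "i \<in> L" "x = \<alpha> powi i"
      using DT by blast
    have "inverse x \<notin> D"
    proof
      \<comment> \<open>The leader \<open>k\<close> of the inverse orbit would lie in T1, as (ii)
        keeps it out of T2. Applying (i) to \<open>k\<close> puts the leader of the orbit inverse to
        that of \<open>k\<close> into T1; by uniqueness this leader is \<open>i\<close>,
        contradicting disjointness.\<close>
      assume inv: "inverse x \<in> D"
      obtain k where k: "k \<in> L" "\<alpha> powi k \<in> frob_orbit CARD('a) (inverse x)"
        using leader_exists inverse_root i(2) by metis
      then have "\<alpha> powi k \<in> T1 \<union> T2"
        using frob_orbit_subset[OF inv D(2)] DT by blast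
      then have "\<alpha> powi k \<in> T1"
        using T2[OF i(1)] coset_neg k x i(2) by blast
      moreover have "x \<in> frob_orbit CARD('a) (inverse (\<alpha> powi k))"
        using frob_orbit_inverse[OF k(2)] orbit_eq alpha_powi_unity_root frob_orbit_self i(2)
        by (metis inverse_inverse_eq)
      then have "i \<in> cyclotomic_coset CARD('a) n (- k)"
        using coset_neg i by blast
      \<comment> \<open>For the self-inverse alternative in (i), where \<open>m\<close> can be taken
        to be \<open>k\<close> itself.\<close>
      moreover have "k \<in> cyclotomic_coset CARD('a) n k"
        using mem_coset_iff k(1) leaders_subset frob_orbit_self by blast
      ultimately obtain m where "m \<in> L" "m \<in> cyclotomic_coset CARD('a) n (- k)" "\<alpha> powi m \<in> T1"
        using T1[OF k(1)] k(1) by blast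
      then have "\<alpha> powi i \<in> T1"
        using leader_unique[OF i(1) _ inverse_root] coset_neg i(1)
          \<open>i \<in> cyclotomic_coset CARD('a) n (- k)\<close> by blast
      then show False
        using x i(2) disj by blast
    qed
    then show "x \<in> R \<inter> ?T"
      using x R_iff DT by blast
  qed
  show "basic_dual_zero hom \<alpha> n L (dual_code n (hull_code n C)) = T2"
    unfolding dual_hull basic_dual_zero_code_of_zeros[OF R] by (rule RT)
  have "bij_betw inverse R (unity_roots - (Z \<union> D))"
    by (rule bij_betw_byWitness[where f' = inverse]) (auto simp: R_def inverse_unity_roots)
  then have "card R = card (unity_roots - (Z \<union> D))"
    by (rule bij_betw_same_card)
  also have "\<dots> = n - card (Z \<union> D)"
    using card_Diff_subset[OF finite_subset[OF ZD(1) finite_unity_roots] ZD(1)] card_unity_roots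
    by simp
  finally have "hull_dim n C = card R"
    unfolding hull_dim_def hull by (simp add: dim_code_of_zeros[OF ZD])
  also have "\<dots> = (\<Sum>i\<in>{i\<in>L. \<alpha> powi i \<in> R}. card (cyclotomic_coset CARD('a) n i))"
    by (rule card_frob_closed[OF R])
  also have "{i\<in>L. \<alpha> powi i \<in> R} = {i\<in>L. \<alpha> powi i \<in> T2}"
    using RT by blast
  finally show "hull_dim n C = (\<Sum>i\<in>{i\<in>L. \<alpha> powi i \<in> T2}. card (cyclotomic_coset CARD('a) n i))" .
qed

end

end

text \<open>The quantifier over \<open>k\<close> replaces the power with exponent \<open>- i\<close>
  by that of the leader of its coset. Disjointness makes T1 and T2 a partition: otherwise two
  inverse orbits in T1, one of them repeated in T2, could satisfy (i) and (ii) although neither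
  survives in the dual of the hull.\<close>

theorem theorem5:
  fixes \<phi> :: "'a :: {field, finite} \<Rightarrow> 'b :: field"
    and \<alpha> :: 'b and q n :: nat and L :: "int set"
    and C :: "'a vec set" and g :: "'a poly" and T T1 T2 :: "'b set"
  assumes "q = CARD('a)"
    and "0 < n" and "coprime n q"
    and "field_hom \<phi>"
    and "primitive_root_of_unity n \<alpha>"
    and "cyclic_code n C" and "generator_poly n C g"
    and "coset_leaders q n L"
    and "T = (\<lambda>i. \<alpha> powi i) ` L"
    and "T1 \<subseteq> T" and "T2 \<subseteq> T" and "T1 \<inter> T2 = {}"
    and "basic_dual_zero \<phi> \<alpha> n L (dual_code n C) = T1 \<union> T2"
    and "\<forall>i\<in>L. \<alpha> powi i \<in> T1 \<longrightarrow>
           cyclotomic_coset q n i = cyclotomic_coset q n (- i) \<or>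
           (\<exists>k\<in>L. k \<in> cyclotomic_coset q n (- i) \<and> \<alpha> powi k \<in> T1)"
    and "\<forall>i\<in>L. \<alpha> powi i \<in> T2 \<longrightarrow>
           cyclotomic_coset q n i \<inter> cyclotomic_coset q n (- i) = {} \<and>
           \<not> (\<exists>k\<in>L. k \<in> cyclotomic_coset q n (- i) \<and> \<alpha> powi k \<in> T2)"
  shows "basic_dual_zero \<phi> \<alpha> n L (dual_code n (hull_code n C)) = T2 \<and>
    hull_dim n C = (\<Sum>i\<in>{i\<in>L. \<alpha> powi i \<in> T2}. card (cyclotomic_coset q n i))"
proof -
  note q = assms(1)
  interpret field_hom \<phi> by (rule assms(4))
  interpret cyclic_codes_coprime \<phi> \<alpha> n
    by unfold_locales (use assms in auto)
  have L: "coset_leaders CARD('a) n L"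
    using assms(8) q by simp
  have "basic_dual_zero \<phi> \<alpha> n L (dual_code n (hull_code n C)) = T2"
    by (rule basic_dual_zero_hull(1)[OF L assms(7,13,12)]) (use assms(14,15) q in auto)
  moreover have "hull_dim n C = (\<Sum>i\<in>{i\<in>L. \<alpha> powi i \<in> T2}. card (cyclotomic_coset CARD('a) n i))"
    by (rule basic_dual_zero_hull(2)[OF L assms(7,13,12)]) (use assms(14,15) q in auto)
  ultimately show ?thesis
    by (simp add: q)
qed

end
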